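(* Let $D$ be a distributive lattice and let $S=\bigcup_{\alpha\in D}G_\alpha$ be a strong distributive lattice of group semirings, where each $G_\alpha$ is a group semiring. Let $E(S)$ denote the set of all multiplicative idempotents of $S$, i.e. $E(S)=\{x\in S: x\cdot x=x\}$. Then: (i) $E(S)=\{e_\alpha:\alpha\in D\}$, where $e_\alpha$ is the identity of the group $(G_\alpha,\cdot)$. (ii) $E(S)$ is a subsemiring of $S$, and $(E(S),+,\cdot)$ is a distributive lattice isomorphic to $D$. (iii) The semigroup $(S,\cdot)$ is a Clifford semigroup. (iv) The semigroup $(S,+)$ is a left normal band.
   Context: Maps are written on the right of their arguments and composed left to right: $x(\phi\psi)=(x\phi)\psi$. A semiring is a structure $(S,+,\cdot)$ where $(S,+)$ and $(S,\cdot)$ are semigroups (addition need not be commutative, and no zero or one is required) and $x(y+z)=xy+xz$, $(x+y)z=xz+yz$ for all $x,y,z$. Homomorphisms of semirings preserve $+$ and $\cdot$. A group semiring is a semiring $(G,+,\cdot)$ where $(G,\cdot)$ is a group and $x+y=x$ for all $x,y\in G$. In a distributive lattice $(D,+,\cdot)$, $+$ denotes join, $\cdot$ denotes meet, and $\beta\le\alpha$ means $\alpha\beta=\beta$. A distributive lattice of semirings is a semiring $S$ which is a disjoint union $S=\bigcup_{\alpha\in D}S_\alpha$ of semirings $S_\alpha$ (each with the operations inherited from $S$) indexed by a distributive lattice $D$, such that $x+y\in S_{\alpha+\beta}$ and $xy\in S_{\alpha\beta}$ whenever $x\in S_\alpha$, $y\in S_\beta$. Such an $S$ is a strong distributive lattice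 of semirings if there are two families of semiring homomorphisms $\{\phi_{\alpha,\beta}:S_\alpha\to S_\beta\mid\beta\le\alpha\}$ and $\{\psi_{\beta,\alpha}:S_\beta\to S_\alpha\mid\beta\le\alpha\}$ such that: - $\phi_{\alpha,\alpha}$ and $\psi_{\alpha,\alpha}$ are the identity map of $S_\alpha$; - $\phi_{\alpha,\beta}\phi_{\beta,\gamma}=\phi_{\alpha,\gamma}$ and $\psi_{\gamma,\beta}\psi_{\beta,\alpha}=\psi_{\gamma,\alpha}$ whenever $\gamma\le\beta\le\alpha$; - if $\alpha+\beta\le\delta$ then $\phi_{\alpha,\alpha\beta}\psi_{\alpha\beta,\beta}=\psi_{\alpha,\delta}\phi_{\delta,\beta}$; - for $x\in S_\alpha$ and $y\in S_\beta$, $xy=(x\phi_{\alpha,\alpha\beta})(y\phi_{\beta,\alpha\beta})$ and $x+y=x\psi_{\alpha,\alpha+\beta}+y\psi_{\beta,\alpha+\beta}$. A strong distributive lattice of group semirings is a strong distributive lattice of semirings in which every $S_\alpha=G_\alpha$ is a group semiring. A Clifford semigroup is a (von Neumann) regular semigroup in which every idempotent commutes with every element (equivalently, a semilattice of groups). A left normal band, written additively, is a semigroup $(S,+)$ with $x+x=x$ and $x+y+z=x+z+y$ for all $x,y,z\in S$. *)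

theory Defs
  imports "HOL-Algebra.Group" "HOL-Library.Disjoint_Sets"
begin

record 'a bialg = "'a partial_object" +
  add_op :: "'a \<Rightarrow> 'a \<Rightarrow> 'a" (infixl \<open>\<boxplus>\<index>\<close> 65)
  mul_op :: "'a \<Rightarrow> 'a \<Rightarrow> 'a" (infixl \<open>\<boxdot>\<index>\<close> 70)

definition is_semigroup :: "'a set \<Rightarrow> ('a \<Rightarrow> 'a \<Rightarrow> 'a) \<Rightarrow> bool" where
  "is_semigroup A f \<longleftrightarrow>
     A \<noteq> {} \<and>
     (\<forall>x\<in>A. \<forall>y\<in>A. f x y \<in> A) \<and>
     (\<forall>x\<in>A. \<forall>y\<in>A. \<forall>z\<in>A. f (f x y) z = f x (f y z))"

definition is_semiring :: "'a bialg \<Rightarrow> bool" where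
  "is_semiring S \<longleftrightarrow>
     is_semigroup (carrier S) (add_op S) \<and>
     is_semigroup (carrier S) (mul_op S) \<and>
     (\<forall>x\<in>carrier S. \<forall>y\<in>carrier S. \<forall>z\<in>carrier S.
        x \<boxdot>\<^bsub>S\<^esub> (y \<boxplus>\<^bsub>S\<^esub> z) = x \<boxdot>\<^bsub>S\<^esub> y \<boxplus>\<^bsub>S\<^esub> x \<boxdot>\<^bsub>S\<^esub> z \<and>
        (x \<boxplus>\<^bsub>S\<^esub> y) \<boxdot>\<^bsub>S\<^esub> z = x \<boxdot>\<^bsub>S\<^esub> z \<boxplus>\<^bsub>S\<^esub> y \<boxdot>\<^bsub>S\<^esub> z)"

abbreviation sub_bialg :: "'a bialg \<Rightarrow> 'a set \<Rightarrow> 'a bialg" where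
  "sub_bialg S A \<equiv> S\<lparr>carrier := A\<rparr>"

definition subsemiring :: "'a set \<Rightarrow> 'a bialg \<Rightarrow> bool" where
  "subsemiring A S \<longleftrightarrow> A \<subseteq> carrier S \<and> is_semiring (sub_bialg S A)"

definition bialg_hom :: "'a bialg \<Rightarrow> 'b bialg \<Rightarrow> ('a \<Rightarrow> 'b) set" where
  "bialg_hom S T =
     {f. f \<in> carrier S \<rightarrow> carrier T \<and>
         (\<forall>x\<in>carrier S. \<forall>y\<in>carrier S.
            f (x \<boxplus>\<^bsub>S\<^esub> y) = f x \<boxplus>\<^bsub>T\<^esub> f y \<and> f (x \<boxdot>\<^bsub>S\<^esub> y) = f x \<boxdot>\<^bsub>T\<^esub> f y)}"

definition bialg_isomorphic :: "'a bialg \<Rightarrow> 'b bialg \<Rightarrow> bool" where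
  "bialg_isomorphic S T \<longleftrightarrow> (\<exists>f\<in>bialg_hom S T. bij_betw f (carrier S) (carrier T))"

definition is_group :: "'a set \<Rightarrow> ('a \<Rightarrow> 'a \<Rightarrow> 'a) \<Rightarrow> bool" where
  "is_group A f \<longleftrightarrow> (\<exists>e. group \<lparr>carrier = A, mult = f, one = e\<rparr>)"

text \<open>Meaningful only when \<^term>\<open>is_group A f\<close> holds; the identity is then unique.\<close>

definition group_identity :: "'a set \<Rightarrow> ('a \<Rightarrow> 'a \<Rightarrow> 'a) \<Rightarrow> 'a" where
  "group_identity A f = (THE e. group \<lparr>carrier = A, mult = f, one = e\<rparr>)"

definition group_semiring :: "'a bialg \<Rightarrow> bool" where
  "group_semiring S \<longleftrightarrow>
     is_semiring S \<and>
     is_group (carrier S) (mul_op S) \<and>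
     (\<forall>x\<in>carrier S. \<forall>y\<in>carrier S. x \<boxplus>\<^bsub>S\<^esub> y = x)"

text \<open>Distributive lattices as algebras, with \<^const>\<open>add_op\<close> as join and \<^const>\<open>mul_op\<close> as meet.\<close>

definition distributive_lattice :: "'a bialg \<Rightarrow> bool" where
  "distributive_lattice D \<longleftrightarrow>
     is_semigroup (carrier D) (add_op D) \<and>
     is_semigroup (carrier D) (mul_op D) \<and>
     (\<forall>a\<in>carrier D. \<forall>b\<in>carrier D.
        a \<boxplus>\<^bsub>D\<^esub> b = b \<boxplus>\<^bsub>D\<^esub> a \<and>
        a \<boxdot>\<^bsub>D\<^esub> b = b \<boxdot>\<^bsub>D\<^esub> a \<and>
        a \<boxplus>\<^bsub>D\<^esub> (a \<boxdot>\<^bsub>D\<^esub> b) = a \<and>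
        a \<boxdot>\<^bsub>D\<^esub> (a \<boxplus>\<^bsub>D\<^esub> b) = a) \<and>
     (\<forall>a\<in>carrier D. \<forall>b\<in>carrier D. \<forall>c\<in>carrier D.
        a \<boxdot>\<^bsub>D\<^esub> (b \<boxplus>\<^bsub>D\<^esub> c) = a \<boxdot>\<^bsub>D\<^esub> b \<boxplus>\<^bsub>D\<^esub> a \<boxdot>\<^bsub>D\<^esub> c)"

definition lattice_le :: "'a bialg \<Rightarrow> 'a \<Rightarrow> 'a \<Rightarrow> bool" where
  "lattice_le D b a \<longleftrightarrow> a \<boxdot>\<^bsub>D\<^esub> b = b"

definition distributive_lattice_of_semirings ::
    "'d bialg \<Rightarrow> ('d \<Rightarrow> 'a set) \<Rightarrow> 'a bialg \<Rightarrow> bool" where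
  "distributive_lattice_of_semirings D G S \<longleftrightarrow>
     distributive_lattice D \<and>
     is_semiring S \<and>
     carrier S = (\<Union>a\<in>carrier D. G a) \<and>
     disjoint_family_on G (carrier D) \<and>
     (\<forall>a\<in>carrier D. is_semiring (sub_bialg S (G a))) \<and>
     (\<forall>a\<in>carrier D. \<forall>b\<in>carrier D. \<forall>x\<in>G a. \<forall>y\<in>G b.
        x \<boxplus>\<^bsub>S\<^esub> y \<in> G (a \<boxplus>\<^bsub>D\<^esub> b) \<and> x \<boxdot>\<^bsub>S\<^esub> y \<in> G (a \<boxdot>\<^bsub>D\<^esub> b))"

text \<open>
  For \<open>b \<le> a\<close>, the maps are \<open>\<phi> a b : G a \<rightarrow> G b\<close> and \<open>\<psi> b a : G b \<rightarrow> G a\<close>.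
  Maps written on the right and composed from left to right become nested applications,
  and two maps are equal when they agree on the carrier of their common domain.
\<close>

definition strong_system ::
    "'d bialg \<Rightarrow> ('d \<Rightarrow> 'a set) \<Rightarrow> 'a bialg \<Rightarrow>
     ('d \<Rightarrow> 'd \<Rightarrow> 'a \<Rightarrow> 'a) \<Rightarrow> ('d \<Rightarrow> 'd \<Rightarrow> 'a \<Rightarrow> 'a) \<Rightarrow> bool" where
  "strong_system D G S \<phi> \<psi> \<longleftrightarrow>
     (\<forall>a\<in>carrier D. \<forall>b\<in>carrier D. lattice_le D b a \<longrightarrow>
        \<phi> a b \<in> bialg_hom (sub_bialg S (G a)) (sub_bialg S (G b)) \<and>
        \<psi> b a \<in> bialg_hom (sub_bialg S (G b)) (sub_bialg S (G a))) \<and>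
     (\<forall>a\<in>carrier D. \<forall>x\<in>G a. \<phi> a a x = x \<and> \<psi> a a x = x) \<and>
     (\<forall>a\<in>carrier D. \<forall>b\<in>carrier D. \<forall>c\<in>carrier D.
        lattice_le D c b \<and> lattice_le D b a \<longrightarrow>
        (\<forall>x\<in>G a. \<phi> b c (\<phi> a b x) = \<phi> a c x) \<and>
        (\<forall>x\<in>G c. \<psi> b a (\<psi> c b x) = \<psi> c a x)) \<and>
     (\<forall>a\<in>carrier D. \<forall>b\<in>carrier D. \<forall>d\<in>carrier D.
        lattice_le D (a \<boxplus>\<^bsub>D\<^esub> b) d \<longrightarrow>
        (\<forall>x\<in>G a. \<psi> (a \<boxdot>\<^bsub>D\<^esub> b) b (\<phi> a (a \<boxdot>\<^bsub>D\<^esub> b) x) = \<phi> d b (\<psi> a d x))) \<and>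
     (\<forall>a\<in>carrier D. \<forall>b\<in>carrier D. \<forall>x\<in>G a. \<forall>y\<in>G b.
        x \<boxdot>\<^bsub>S\<^esub> y = \<phi> a (a \<boxdot>\<^bsub>D\<^esub> b) x \<boxdot>\<^bsub>S\<^esub> \<phi> b (a \<boxdot>\<^bsub>D\<^esub> b) y \<and>
        x \<boxplus>\<^bsub>S\<^esub> y = \<psi> a (a \<boxplus>\<^bsub>D\<^esub> b) x \<boxplus>\<^bsub>S\<^esub> \<psi> b (a \<boxplus>\<^bsub>D\<^esub> b) y)"

definition strong_distributive_lattice_of_semirings ::
    "'d bialg \<Rightarrow> ('d \<Rightarrow> 'a set) \<Rightarrow> 'a bialg \<Rightarrow> bool" where
  "strong_distributive_lattice_of_semirings D G S \<longleftrightarrow>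
     distributive_lattice_of_semirings D G S \<and> (\<exists>\<phi> \<psi>. strong_system D G S \<phi> \<psi>)"

definition strong_distributive_lattice_of_group_semirings ::
    "'d bialg \<Rightarrow> ('d \<Rightarrow> 'a set) \<Rightarrow> 'a bialg \<Rightarrow> bool" where
  "strong_distributive_lattice_of_group_semirings D G S \<longleftrightarrow>
     strong_distributive_lattice_of_semirings D G S \<and>
     (\<forall>a\<in>carrier D. group_semiring (sub_bialg S (G a)))"

definition mult_idempotents :: "'a bialg \<Rightarrow> 'a set" where
  "mult_idempotents S = {x \<in> carrier S. x \<boxdot>\<^bsub>S\<^esub> x = x}"

definition clifford_semigroup :: "'a set \<Rightarrow> ('a \<Rightarrow> 'a \<Rightarrow> 'a) \<Rightarrow> bool" where
  "clifford_semigroup A f \<longleftrightarrow>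
     is_semigroup A f \<and>
     (\<forall>x\<in>A. \<exists>y\<in>A. f (f x y) x = x) \<and>
     (\<forall>e\<in>A. f e e = e \<longrightarrow> (\<forall>x\<in>A. f e x = f x e))"

definition left_normal_band :: "'a set \<Rightarrow> ('a \<Rightarrow> 'a \<Rightarrow> 'a) \<Rightarrow> bool" where
  "left_normal_band A f \<longleftrightarrow>
     is_semigroup A f \<and>
     (\<forall>x\<in>A. f x x = x) \<and>
     (\<forall>x\<in>A. \<forall>y\<in>A. \<forall>z\<in>A. f (f x y) z = f (f x z) y)"

end

(*
  A homomorphism of groups preserves idempotents, i.e. identities, so the identities e_a satisfy
  e_a e_b = e_(ab) and e_a + e_b = e_(a+b). Hence a \<mapsto> e_a is a surjective homomorphism from D onto
  E(S), injective because the G_a are disjoint, and E(S) inherits the laws of a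
  distributive lattice. Multiplying x from G_b by e_a yields the image of x in G_(ab) on either
  side, so idempotents are central. Since addition in each G_a is the left projection, x + y is
  the image of x in G_(a+b); it depends only on x and a + b, whence the left normal band.
*)
theory Submission imports Defs begin

section \<open>Identities, idempotents and regularity in a group\<close>

text \<open>Justifies the definite description in \<open>group_identity\<close>, so that the
  identity laws can be read off from it.\<close>

lemma group_with_group_identity:
  assumes "is_group A f"
  shows "group \<lparr>carrier = A, mult = f, one = group_identity A f\<rparr>"
proof -
  obtain e where e: "group \<lparr>carrier = A, mult = f, one = e\<rparr>"
    using assms by (auto simp: is_group_def)
  have unique: "e' = e" if "group \<lparr>carrier = A, mult = f, one = e'\<rparr>" for e'
  proof -
    interpret g: group "\<lparr>carrier = A, mult = f, one = e\<rparr>" by (rule e)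
    interpret h: group "\<lparr>carrier = A, mult = f, one = e'\<rparr>" by (rule that)
    \<comment> \<open>The product of the two candidates equals each of them: \<open>e\<close> is a
      right identity and \<open>e'\<close> a left one.\<close>
    have "f e' e = e'" using g.r_one[of e'] h.one_closed by simp
    moreover have "f e' e = e" using h.l_one[of e] g.one_closed by simp
    ultimately show ?thesis by simp
  qed
  show ?thesis
    unfolding group_identity_def
    by (rule theI[where P = "\<lambda>e. group \<lparr>carrier = A, mult = f, one = e\<rparr>", OF e unique])
qed

lemma group_identity_closed: "is_group A f \<Longrightarrow> group_identity A f \<in> A"
  using group.is_monoid[OF group_with_group_identity, THEN monoid.one_closed] by fastforce

lemma group_identity_left: "is_group A f \<Longrightarrow> x \<in> A \<Longrightarrow> f (group_identity A f) x = x"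
  using group.is_monoid[OF group_with_group_identity, THEN monoid.l_one] by fastforce

lemma group_identity_right: "is_group A f \<Longrightarrow> x \<in> A \<Longrightarrow> f x (group_identity A f) = x"
  using group.is_monoid[OF group_with_group_identity, THEN monoid.r_one] by fastforce

text \<open>Cancelling the left factor in \<open>f x x = x\<close> leaves the identity.\<close>

lemma group_idempotent_iff:
  assumes "is_group A f" and "x \<in> A"
  shows "f x x = x \<longleftrightarrow> x = group_identity A f"
proof -
  interpret group "\<lparr>carrier = A, mult = f, one = group_identity A f\<rparr>"
    by (rule group_with_group_identity[OF assms(1)])
  show ?thesis using l_cancel_one[of x x] assms(2) by simp
qed

text \<open>A right inverse \<open>y\<close> of \<open>x\<close> works: (xy)x = 1x = x.\<close>

lemma group_regular:
  assumes "is_group A f" and "x \<in> A"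
  shows "\<exists>y\<in>A. f (f x y) x = x"
proof -
  interpret group "\<lparr>carrier = A, mult = f, one = group_identity A f\<rparr>"
    by (rule group_with_group_identity[OF assms(1)])
  obtain y where "y \<in> A" "f x y = group_identity A f"
    using r_inv_ex[of x] assms(2) by auto
  with l_one[of x] assms(2) show ?thesis by (intro bexI[of _ y]) simp_all
qed

section \<open>Transfer along homomorphisms and inversion of isomorphisms\<close>

text \<open>The definition of a distributive lattice states left distributivity alone; the
  right-hand law follows because meet is commutative.\<close>

lemma distributive_lattice_is_semiring:
  assumes "distributive_lattice D"
  shows "is_semiring D"
  using assms unfolding distributive_lattice_def is_semiring_def
  by (auto simp: is_semigroup_def)

text \<open>The lattice laws are equations, so they pass to homomorphic images: each element of
  \<open>E\<close> is some \<open>f a\<close>, and both sides of a law in \<open>E\<close> are the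
  images of its two sides in \<open>D\<close>.\<close>

lemma distributive_lattice_surj_hom:
  assumes "distributive_lattice D" and "f \<in> bialg_hom D E" and "f ` carrier D = carrier E"
  shows "distributive_lattice E"
proof -
  have add: "add_op E (f a) (f b) = f (add_op D a b)"
    and mul: "mul_op E (f a) (f b) = f (mul_op D a b)"
    if "a \<in> carrier D" "b \<in> carrier D" for a b
    using assms(2) that by (auto simp: bialg_hom_def)
  have closed: "add_op D a b \<in> carrier D" "mul_op D a b \<in> carrier D"
    if "a \<in> carrier D" "b \<in> carrier D" for a b
    using assms(1) that by (auto simp: distributive_lattice_def is_semigroup_def)
  have comm: "add_op D a b = add_op D b a" "mul_op D a b = mul_op D b a"
    and absorb: "add_op D a (mul_op D a b) = a" "mul_op D a (add_op D a b) = a"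
    if "a \<in> carrier D" "b \<in> carrier D" for a b
    using assms(1) that by (simp_all add: distributive_lattice_def)
  have assoc: "add_op D (add_op D a b) c = add_op D a (add_op D b c)"
      "mul_op D (mul_op D a b) c = mul_op D a (mul_op D b c)"
    and distrib: "mul_op D a (add_op D b c) = add_op D (mul_op D a b) (mul_op D a c)"
    if "a \<in> carrier D" "b \<in> carrier D" "c \<in> carrier D" for a b c
    using assms(1) that unfolding distributive_lattice_def is_semigroup_def by blast+
  have nonempty: "carrier D \<noteq> {}"
    using assms(1) by (simp add: distributive_lattice_def is_semigroup_def)
  show ?thesis
    unfolding distributive_lattice_def is_semigroup_def assms(3)[symmetric]
    by (simp add: add mul closed assoc absorb distrib nonempty) (simp add: comm)
qed

text \<open>The inverse bijection is again a homomorphism. The semiring assumption supplies closure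
  of \<open>S\<close>, so that \<open>g\<close> cancels \<open>f\<close> on sums and products as
  well.\<close>

lemma bialg_isomorphic_sym:
  assumes "is_semiring S" and "bialg_isomorphic S T"
  shows "bialg_isomorphic T S"
proof -
  obtain f where f: "f \<in> bialg_hom S T" and bij: "bij_betw f (carrier S) (carrier T)"
    using assms(2) by (auto simp: bialg_isomorphic_def)
  define g where "g = inv_into (carrier S) f"
  have g: "bij_betw g (carrier T) (carrier S)"
    using bij_betw_inv_into[OF bij] by (simp add: g_def)
  have gf: "g (f x) = x" if "x \<in> carrier S" for x
    using bij that by (simp add: g_def bij_betw_inv_into_left)
  have image: "carrier T = f ` carrier S"
    using bij by (simp add: bij_betw_def)
  have add: "add_op T (f x) (f y) = f (add_op S x y)"
    and mul: "mul_op T (f x) (f y) = f (mul_op S x y)"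
    if "x \<in> carrier S" "y \<in> carrier S" for x y
    using f that by (auto simp: bialg_hom_def)
  have closed: "add_op S x y \<in> carrier S" "mul_op S x y \<in> carrier S"
    if "x \<in> carrier S" "y \<in> carrier S" for x y
    using assms(1) that by (auto simp: is_semiring_def is_semigroup_def)
  have "g \<in> bialg_hom T S"
    unfolding bialg_hom_def image by (auto simp: gf add mul closed)
  with g show ?thesis by (auto simp: bialg_isomorphic_def)
qed

section \<open>The union of group semirings and its index lattice\<close>

text \<open>The definition of a strong lattice only asserts that the two families of maps exist;
  here one choice is fixed, so that the lemmas can speak of it.\<close>

locale strong_lattice_of_group_semirings =
  fixes D :: "'d bialg" and S :: "'a bialg" and G :: "'d \<Rightarrow> 'a set"
    and \<phi> \<psi> :: "'d \<Rightarrow> 'd \<Rightarrow> 'a \<Rightarrow> 'a"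
  assumes lattice_of_semirings: "distributive_lattice_of_semirings D G S"
    and system: "strong_system D G S \<phi> \<psi>"
    and fibre_group_semiring: "\<And>a. a \<in> carrier D \<Longrightarrow> group_semiring (sub_bialg S (G a))"
begin

abbreviation unit_of :: "'d \<Rightarrow> 'a" where
  "unit_of a \<equiv> group_identity (G a) (mul_op S)"

lemma lattice: "distributive_lattice D"
  and semiring: "is_semiring S"
  and carrier_eq: "carrier S = (\<Union>a\<in>carrier D. G a)"
  and disjoint: "disjoint_family_on G (carrier D)"
  using lattice_of_semirings by (auto simp: distributive_lattice_of_semirings_def)

lemma fibre_group: "a \<in> carrier D \<Longrightarrow> is_group (G a) (mul_op S)"
  using fibre_group_semiring[of a] by (simp add: group_semiring_def)

lemma fibre_add: "a \<in> carrier D \<Longrightarrow> x \<in> G a \<Longrightarrow> y \<in> G a \<Longrightarrow> x \<boxplus>\<^bsub>S\<^esub> y = x"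
  using fibre_group_semiring[of a] by (simp add: group_semiring_def)

lemma unit_of_closed: "a \<in> carrier D \<Longrightarrow> unit_of a \<in> G a"
  by (intro group_identity_closed fibre_group)

lemma join_closed: "a \<in> carrier D \<Longrightarrow> b \<in> carrier D \<Longrightarrow> a \<boxplus>\<^bsub>D\<^esub> b \<in> carrier D"
  and meet_closed: "a \<in> carrier D \<Longrightarrow> b \<in> carrier D \<Longrightarrow> a \<boxdot>\<^bsub>D\<^esub> b \<in> carrier D"
  and join_comm: "a \<in> carrier D \<Longrightarrow> b \<in> carrier D \<Longrightarrow> a \<boxplus>\<^bsub>D\<^esub> b = b \<boxplus>\<^bsub>D\<^esub> a"
  and meet_comm: "a \<in> carrier D \<Longrightarrow> b \<in> carrier D \<Longrightarrow> a \<boxdot>\<^bsub>D\<^esub> b = b \<boxdot>\<^bsub>D\<^esub> a"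
  and meet_assoc: "a \<in> carrier D \<Longrightarrow> b \<in> carrier D \<Longrightarrow> c \<in> carrier D \<Longrightarrow>
    a \<boxdot>\<^bsub>D\<^esub> b \<boxdot>\<^bsub>D\<^esub> c = a \<boxdot>\<^bsub>D\<^esub> (b \<boxdot>\<^bsub>D\<^esub> c)"
  and join_absorb: "a \<in> carrier D \<Longrightarrow> b \<in> carrier D \<Longrightarrow> a \<boxplus>\<^bsub>D\<^esub> (a \<boxdot>\<^bsub>D\<^esub> b) = a"
  and meet_absorb: "a \<in> carrier D \<Longrightarrow> b \<in> carrier D \<Longrightarrow> a \<boxdot>\<^bsub>D\<^esub> (a \<boxplus>\<^bsub>D\<^esub> b) = a"
  using lattice by (auto simp: distributive_lattice_def is_semigroup_def)

text \<open>Both absorption laws combine: aa = a(a + aa) = a.\<close>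

lemma meet_idem: "a \<in> carrier D \<Longrightarrow> a \<boxdot>\<^bsub>D\<^esub> a = a"
  by (metis join_absorb meet_absorb meet_closed)

lemma le_join: "a \<in> carrier D \<Longrightarrow> b \<in> carrier D \<Longrightarrow> lattice_le D a (a \<boxplus>\<^bsub>D\<^esub> b)"
  by (simp add: lattice_le_def meet_comm[of "a \<boxplus>\<^bsub>D\<^esub> b" a] join_closed meet_absorb)

lemma meet_le: "a \<in> carrier D \<Longrightarrow> b \<in> carrier D \<Longrightarrow> lattice_le D (a \<boxdot>\<^bsub>D\<^esub> b) a"
  by (simp add: lattice_le_def meet_assoc[symmetric] meet_idem)

section \<open>The structure maps and the operations they determine\<close>

text \<open>Writing the target index as a meet, and as a join in \<open>\<psi>_hom\<close>, builds
  in the order condition, since ab \<le> a and a \<le> a + b always hold.\<close>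

lemma \<phi>_hom:
  assumes "a \<in> carrier D" "b \<in> carrier D"
  shows "\<phi> a (a \<boxdot>\<^bsub>D\<^esub> b) \<in> bialg_hom (sub_bialg S (G a)) (sub_bialg S (G (a \<boxdot>\<^bsub>D\<^esub> b)))"
  using system meet_le[OF assms] meet_closed[OF assms] assms(1)
  by (simp add: strong_system_def)

lemma \<psi>_hom:
  assumes "a \<in> carrier D" "b \<in> carrier D"
  shows "\<psi> a (a \<boxplus>\<^bsub>D\<^esub> b) \<in> bialg_hom (sub_bialg S (G a)) (sub_bialg S (G (a \<boxplus>\<^bsub>D\<^esub> b)))"
  using system le_join[OF assms] join_closed[OF assms] assms(1)
  by (simp add: strong_system_def)

text \<open>The image of an idempotent is idempotent, and the target group has no idempotent besides
  its identity.\<close>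

lemma hom_unit_of:
  assumes "a \<in> carrier D" "b \<in> carrier D"
    and f: "f \<in> bialg_hom (sub_bialg S (G a)) (sub_bialg S (G b))"
  shows "f (unit_of a) = unit_of b"
proof -
  have "mul_op S (unit_of a) (unit_of a) = unit_of a"
    using assms(1) by (intro group_identity_left fibre_group unit_of_closed)
  with f unit_of_closed[OF assms(1)]
  have "f (unit_of a) \<in> G b" "mul_op S (f (unit_of a)) (f (unit_of a)) = f (unit_of a)"
    by (force simp: bialg_hom_def)+
  with group_idempotent_iff[OF fibre_group[OF assms(2)]] show ?thesis by blast
qed

lemma \<phi>_unit_of:
  assumes "a \<in> carrier D" "b \<in> carrier D"
  shows "\<phi> a (a \<boxdot>\<^bsub>D\<^esub> b) (unit_of a) = unit_of (a \<boxdot>\<^bsub>D\<^esub> b)"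
  using assms by (intro hom_unit_of \<phi>_hom meet_closed)

lemma \<psi>_unit_of:
  assumes "a \<in> carrier D" "b \<in> carrier D"
  shows "\<psi> a (a \<boxplus>\<^bsub>D\<^esub> b) (unit_of a) = unit_of (a \<boxplus>\<^bsub>D\<^esub> b)"
  using assms by (intro hom_unit_of \<psi>_hom join_closed)

lemma mul_eq:
  assumes "a \<in> carrier D" "b \<in> carrier D" "x \<in> G a" "y \<in> G b"
  shows "x \<boxdot>\<^bsub>S\<^esub> y = \<phi> a (a \<boxdot>\<^bsub>D\<^esub> b) x \<boxdot>\<^bsub>S\<^esub> \<phi> b (a \<boxdot>\<^bsub>D\<^esub> b) y"
  using system assms unfolding strong_system_def by blast

lemma \<phi>_closed:
  "a \<in> carrier D \<Longrightarrow> b \<in> carrier D \<Longrightarrow> x \<in> G a \<Longrightarrow> \<phi> a (a \<boxdot>\<^bsub>D\<^esub> b) x \<in> G (a \<boxdot>\<^bsub>D\<^esub> b)"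
  using \<phi>_hom[of a b] by (auto simp: bialg_hom_def)

lemma \<psi>_closed:
  "a \<in> carrier D \<Longrightarrow> b \<in> carrier D \<Longrightarrow> x \<in> G a \<Longrightarrow> \<psi> a (a \<boxplus>\<^bsub>D\<^esub> b) x \<in> G (a \<boxplus>\<^bsub>D\<^esub> b)"
  using \<psi>_hom[of a b] by (auto simp: bialg_hom_def)

lemma add_eq_\<psi>:
  assumes "a \<in> carrier D" "b \<in> carrier D" "x \<in> G a" "y \<in> G b"
  shows "x \<boxplus>\<^bsub>S\<^esub> y = \<psi> a (a \<boxplus>\<^bsub>D\<^esub> b) x"
proof -
  have "x \<boxplus>\<^bsub>S\<^esub> y = \<psi> a (a \<boxplus>\<^bsub>D\<^esub> b) x \<boxplus>\<^bsub>S\<^esub> \<psi> b (a \<boxplus>\<^bsub>D\<^esub> b) y"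
    using system assms unfolding strong_system_def by blast
  \<comment> \<open>Both summands now lie in one fibre, where addition is the left projection;
    \<open>join_comm\<close> matches the two forms of its index.\<close>
  also have "\<dots> = \<psi> a (a \<boxplus>\<^bsub>D\<^esub> b) x"
    using assms \<psi>_closed[of a b x] \<psi>_closed[of b a y]
    by (intro fibre_add[of "a \<boxplus>\<^bsub>D\<^esub> b"]) (simp_all add: join_closed join_comm[of b a])
  finally show ?thesis .
qed

section \<open>Multiplication by identities and the lattice of idempotents\<close>

lemma unit_of_mul_left:
  assumes "a \<in> carrier D" "b \<in> carrier D" "x \<in> G b"
  shows "unit_of a \<boxdot>\<^bsub>S\<^esub> x = \<phi> b (b \<boxdot>\<^bsub>D\<^esub> a) x"
  using mul_eq[OF assms(1,2) unit_of_closed assms(3)] assms \<phi>_unit_of[of a b]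
    group_identity_left[OF fibre_group \<phi>_closed, of b a x]
  by (simp add: meet_comm[of a b] meet_closed)

lemma unit_of_mul_right:
  assumes "a \<in> carrier D" "b \<in> carrier D" "x \<in> G b"
  shows "x \<boxdot>\<^bsub>S\<^esub> unit_of a = \<phi> b (b \<boxdot>\<^bsub>D\<^esub> a) x"
  using mul_eq[OF assms(2,1,3) unit_of_closed] assms \<phi>_unit_of[of a b]
    group_identity_right[OF fibre_group \<phi>_closed, of b a x]
  by (simp add: meet_comm[of a b] meet_closed)

lemma unit_of_mul:
  "a \<in> carrier D \<Longrightarrow> b \<in> carrier D \<Longrightarrow> unit_of a \<boxdot>\<^bsub>S\<^esub> unit_of b = unit_of (a \<boxdot>\<^bsub>D\<^esub> b)"
  using unit_of_mul_right[of b a "unit_of a"] \<phi>_unit_of[of a b]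
  by (simp add: unit_of_closed)

lemma unit_of_add:
  "a \<in> carrier D \<Longrightarrow> b \<in> carrier D \<Longrightarrow> unit_of a \<boxplus>\<^bsub>S\<^esub> unit_of b = unit_of (a \<boxplus>\<^bsub>D\<^esub> b)"
  using add_eq_\<psi>[of a b "unit_of a" "unit_of b"] \<psi>_unit_of[of a b]
  by (simp add: unit_of_closed)

text \<open>Whether xx = x holds is decided inside the group containing x, so each fibre contributes
  exactly its identity.\<close>

lemma mult_idempotents_eq: "mult_idempotents S = unit_of ` carrier D"
  unfolding mult_idempotents_def carrier_eq
  using group_idempotent_iff[OF fibre_group] unit_of_closed by blast

lemma unit_of_inj: "inj_on unit_of (carrier D)"
proof (rule inj_onI, rule ccontr)
  fix a b
  assume "a \<in> carrier D" "b \<in> carrier D" "unit_of a = unit_of b" "a \<noteq> b"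
  with unit_of_closed[of a] unit_of_closed[of b] disjoint show False
    by (auto simp: disjoint_family_on_def)
qed

lemma unit_of_hom: "unit_of \<in> bialg_hom D (sub_bialg S (mult_idempotents S))"
  by (auto simp: bialg_hom_def mult_idempotents_eq unit_of_mul unit_of_add)

lemma mult_idempotents_lattice: "distributive_lattice (sub_bialg S (mult_idempotents S))"
  by (rule distributive_lattice_surj_hom[OF lattice unit_of_hom])
    (simp add: mult_idempotents_eq)

text \<open>Closure comes with the lattice structure: a distributive lattice is a semiring under the
  same operations.\<close>

lemma mult_idempotents_subsemiring: "subsemiring (mult_idempotents S) S"
  using distributive_lattice_is_semiring[OF mult_idempotents_lattice]
  by (auto simp: subsemiring_def mult_idempotents_def)

text \<open>The map \<open>unit_of\<close> runs from \<open>D\<close> to the idempotents, so the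
  isomorphism is obtained in that direction and then inverted.\<close>

lemma mult_idempotents_isomorphic: "bialg_isomorphic (sub_bialg S (mult_idempotents S)) D"
proof (rule bialg_isomorphic_sym[OF distributive_lattice_is_semiring[OF lattice]])
  have "bij_betw unit_of (carrier D) (carrier (sub_bialg S (mult_idempotents S)))"
    by (simp add: bij_betw_def unit_of_inj mult_idempotents_eq)
  with unit_of_hom show "bialg_isomorphic D (sub_bialg S (mult_idempotents S))"
    unfolding bialg_isomorphic_def by blast
qed

section \<open>The multiplicative semigroup\<close>

lemma clifford: "clifford_semigroup (carrier S) (mul_op S)"
  unfolding clifford_semigroup_def
proof (intro conjI ballI impI)
  show "is_semigroup (carrier S) (mul_op S)"
    using semiring by (simp add: is_semiring_def)
next
  fix x
  assume "x \<in> carrier S"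
  then show "\<exists>y\<in>carrier S. x \<boxdot>\<^bsub>S\<^esub> y \<boxdot>\<^bsub>S\<^esub> x = x"
    \<comment> \<open>The witness is found in the fibre of \<open>x\<close>.\<close>
    unfolding carrier_eq using group_regular[OF fibre_group] by blast
next
  fix e x
  assume "e \<in> carrier S" "e \<boxdot>\<^bsub>S\<^esub> e = e" "x \<in> carrier S"
  moreover from this obtain b where "b \<in> carrier D" "x \<in> G b"
    by (auto simp: carrier_eq)
  moreover obtain a where "a \<in> carrier D" "e = unit_of a"
    using calculation mult_idempotents_eq by (auto simp: mult_idempotents_def)
  ultimately show "e \<boxdot>\<^bsub>S\<^esub> x = x \<boxdot>\<^bsub>S\<^esub> e"
    by (simp add: unit_of_mul_left unit_of_mul_right)
qed

section \<open>The additive semigroup\<close>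

text \<open>Reassociated as x + (y + z), the sum takes a single use of \<open>add_eq_\<psi>\<close>.
  The summands \<open>y\<close> and \<open>z\<close> survive only through b + c, which is symmetric
  in their indices.\<close>

lemma add_add_eq_\<psi>:
  assumes "a \<in> carrier D" "b \<in> carrier D" "c \<in> carrier D" "x \<in> G a" "y \<in> G b" "z \<in> G c"
  shows "x \<boxplus>\<^bsub>S\<^esub> y \<boxplus>\<^bsub>S\<^esub> z = \<psi> a (a \<boxplus>\<^bsub>D\<^esub> (b \<boxplus>\<^bsub>D\<^esub> c)) x"
proof -
  have "x \<boxplus>\<^bsub>S\<^esub> y \<boxplus>\<^bsub>S\<^esub> z = x \<boxplus>\<^bsub>S\<^esub> (y \<boxplus>\<^bsub>S\<^esub> z)"
    using semiring assms by (auto simp: is_semiring_def is_semigroup_def carrier_eq)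
  moreover have "y \<boxplus>\<^bsub>S\<^esub> z \<in> G (b \<boxplus>\<^bsub>D\<^esub> c)"
    using assms by (simp add: add_eq_\<psi> \<psi>_closed)
  ultimately show ?thesis
    using assms by (simp add: add_eq_\<psi>[of a "b \<boxplus>\<^bsub>D\<^esub> c"] join_closed)
qed

lemma left_normal: "left_normal_band (carrier S) (add_op S)"
  unfolding left_normal_band_def
proof (intro conjI ballI)
  show "is_semigroup (carrier S) (add_op S)"
    using semiring by (simp add: is_semiring_def)
next
  fix x
  assume "x \<in> carrier S"
  then show "x \<boxplus>\<^bsub>S\<^esub> x = x"
    using fibre_add by (auto simp: carrier_eq)
next
  fix x y z
  assume "x \<in> carrier S" "y \<in> carrier S" "z \<in> carrier S"
  then obtain a b c where "a \<in> carrier D" "b \<in> carrier D" "c \<in> carrier D"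
      "x \<in> G a" "y \<in> G b" "z \<in> G c"
    by (auto simp: carrier_eq)
  then show "x \<boxplus>\<^bsub>S\<^esub> y \<boxplus>\<^bsub>S\<^esub> z = x \<boxplus>\<^bsub>S\<^esub> z \<boxplus>\<^bsub>S\<^esub> y"
    using add_add_eq_\<psi>[of a b c x y z] add_add_eq_\<psi>[of a c b x z y] join_comm[of b c] by simp
qed

end

theorem theorem3p6:
  fixes D :: "'d bialg" and S :: "'a bialg" and G :: "'d \<Rightarrow> 'a set"
  assumes "distributive_lattice D"
    and "strong_distributive_lattice_of_group_semirings D G S"
  shows "mult_idempotents S = {group_identity (G a) (mul_op S) | a. a \<in> carrier D} \<and>
    (subsemiring (mult_idempotents S) S \<and>
     distributive_lattice (sub_bialg S (mult_idempotents S)) \<and>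
     bialg_isomorphic (sub_bialg S (mult_idempotents S)) D) \<and>
    clifford_semigroup (carrier S) (mul_op S) \<and>
    left_normal_band (carrier S) (add_op S)"
proof -
  obtain \<phi> \<psi> where "strong_lattice_of_group_semirings D S G \<phi> \<psi>"
    using assms(2)
    by (auto simp: strong_distributive_lattice_of_group_semirings_def
        strong_distributive_lattice_of_semirings_def strong_lattice_of_group_semirings_def)
  then interpret strong_lattice_of_group_semirings D S G \<phi> \<psi> .
  have "mult_idempotents S = {unit_of a | a. a \<in> carrier D}"
    by (auto simp: mult_idempotents_eq)
  then show ?thesis
    using mult_idempotents_subsemiring mult_idempotents_lattice mult_idempotents_isomorphic
      clifford left_normal by blast
qed

end
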